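(* If $X_1,X_2,\dots$ is a sequence of exchangeable random variables with variance at most $\sigma^2$, then for any $k>1$, $$P\left(\sup_{m\ge1}|\bar X_m-\mathbb E X|\ge k\sigma\right)\le\frac1{k^2}.$$ If the random variables are further assumed to be i.i.d., then for any $n\ge1$, we have $$P\left(\sup_{m\ge n}|\bar X_m-\mathbb E X|\ge\frac{k\sigma}{\sqrt n}\right)\le\frac1{k^2}.$$
   Context: Here $\bar X_m=\frac1m\sum_{i=1}^m X_i$ and $\mathbb E X$ denotes the common mean of the $X_i$. A sequence $X_1,X_2,\dots$ is exchangeable if, for any $n\ge1$ and any permutation $\pi$ of $\{1,\dots,n\}$, the joint distribution of $(X_1,\dots,X_n)$ equals that of $(X_{\pi(1)},\dots,X_{\pi(n)})$.
   Formalization: The formal statement assumes σ > 0; for σ = 0 the claim fails, since both events then have probability 1 > 1/k² (for instance when all variables are 0). *)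

theory Defs
  imports "HOL-Probability.Probability"
begin

text \<open>
  Sequences of random variables are indexed by \<open>1, 2, \<dots>\<close>; the value \<open>X 0\<close> plays no role.
\<close>

definition exchangeable :: "'a measure \<Rightarrow> (nat \<Rightarrow> 'a \<Rightarrow> real) \<Rightarrow> bool" where
  "exchangeable M X \<longleftrightarrow>
     (\<forall>i\<ge>1. X i \<in> borel_measurable M) \<and>
     (\<forall>n\<ge>1. \<forall>\<pi>. \<pi> permutes {1..n} \<longrightarrow>
        distr M (\<Pi>\<^sub>M i\<in>{1..n}. borel) (\<lambda>\<omega>. \<lambda>i\<in>{1..n}. X i \<omega>) =
        distr M (\<Pi>\<^sub>M i\<in>{1..n}. borel) (\<lambda>\<omega>. \<lambda>i\<in>{1..n}. X (\<pi> i) \<omega>))"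

definition iid :: "'a measure \<Rightarrow> (nat \<Rightarrow> 'a \<Rightarrow> real) \<Rightarrow> bool" where
  "iid M X \<longleftrightarrow>
     prob_space.indep_vars M (\<lambda>_. borel) X {1..} \<and>
     (\<forall>i\<ge>1. \<forall>j\<ge>1. distr M borel (X i) = distr M borel (X j))"

definition sample_mean :: "(nat \<Rightarrow> 'a \<Rightarrow> real) \<Rightarrow> nat \<Rightarrow> 'a \<Rightarrow> real" where
  "sample_mean X m \<omega> = (\<Sum>i=1..m. X i \<omega>) / real m"

text \<open>
  The supremum is taken in the extended reals, since it may be infinite at some
  points of the sample space.  By exchangeability all \<open>X i\<close> have the same mean,
  so the common mean is that of \<open>X 1\<close>.
\<close>

definition sup_deviation :: "'a measure \<Rightarrow> (nat \<Rightarrow> 'a \<Rightarrow> real) \<Rightarrow> nat \<Rightarrow> 'a \<Rightarrow> ereal" where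
  "sup_deviation M X n \<omega> =
     (SUP m\<in>{n..}. ereal \<bar>sample_mean X m \<omega> - prob_space.expectation M (X 1)\<bar>)"

end

theory Submission
  imports Defs
begin

text \<open>
  For exchangeable variables the squared deviations \<open>A\<^sub>m\<^sup>2\<close> of the sample means form a reverse
  submartingale.  Split the event that \<open>\<bar>A\<^sub>m\<bar> \<ge> c\<close> for some \<open>n \<le> m \<le> N\<close> according to the last
  such \<open>m\<close>.  Each piece \<open>B\<close> depends on the first \<open>m\<close> variables only through their sum, so it is
  invariant under permuting them, and
  \<open>c\<^sup>2 P(B) \<le> E[A\<^sub>m\<^sup>2; B] \<le> E[A\<^sub>n\<^sup>2; B]\<close>.  Summing over the pieces gives the bound
  \<open>E[A\<^sub>n\<^sup>2] / c\<^sup>2\<close>, uniformly in \<open>N\<close>.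
\<close>

section \<open>Centred means and exceedances of a real sequence\<close>

text \<open>Acts on bare real sequences rather than on random variables, so that permuting the
  argument and integrating against a joint law both make sense. The centre \<open>a\<close> stays
  arbitrary until second moments are bounded.\<close>

definition centred_mean :: "real \<Rightarrow> nat \<Rightarrow> (nat \<Rightarrow> real) \<Rightarrow> real" where
  "centred_mean a m x = (\<Sum>i=1..m. x i) / real m - a"

text \<open>The finite horizon \<open>N\<close> ensures that a last exceedance exists as soon as
  there is one; it is removed at the end by a limit.\<close>

definition last_exceedance :: "real \<Rightarrow> real \<Rightarrow> nat \<Rightarrow> nat \<Rightarrow> (nat \<Rightarrow> real) \<Rightarrow> bool" where
  "last_exceedance a c N m x \<longleftrightarrow>
     c \<le> \<bar>centred_mean a m x\<bar> \<and> (\<forall>j\<in>{m<..N}. \<bar>centred_mean a j x\<bar> < c)"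

lemma sample_mean_eq_centred_mean:
  "sample_mean X m \<omega> - a = centred_mean a m (\<lambda>i. X i \<omega>)"
  by (simp add: sample_mean_def centred_mean_def)

lemma centred_mean_cong:
  "(\<And>i. i \<in> {1..m} \<Longrightarrow> x i = y i) \<Longrightarrow> centred_mean a m x = centred_mean a m y"
  by (simp add: centred_mean_def)

lemma last_exceedance_cong:
  assumes "\<And>i. i \<in> {1..N} \<Longrightarrow> x i = y i" "m \<le> N"
  shows "last_exceedance a c N m x = last_exceedance a c N m y"
proof -
  have "centred_mean a j x = centred_mean a j y" if "j \<le> N" for j
    using that assms(1) by (intro centred_mean_cong) auto
  then show ?thesis using assms(2) by (auto simp: last_exceedance_def)
qed

text \<open>With \<open>n \<le> m\<close> the permutation only reorders the summands.\<close>

lemma centred_mean_permute: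
  assumes "\<pi> permutes {1..n}" "n \<le> m"
  shows "centred_mean a m (\<lambda>i. x (\<pi> i)) = centred_mean a m x"
proof -
  have "\<pi> permutes {1..m}"
    using assms by (auto intro: permutes_subset)
  then have "(\<Sum>i=1..m. x (\<pi> i)) = (\<Sum>i=1..m. x i)"
    using sum.permute[of \<pi> "{1..m}" x] by (simp add: o_def)
  then show ?thesis by (simp add: centred_mean_def)
qed

text \<open>Every mean inspected has index at least \<open>m\<close>, hence sums over all the
  permuted coordinates. This symmetry keeps the event fixed while the terms of a shorter mean are
  exchanged.\<close>

lemma last_exceedance_permute:
  assumes "\<pi> permutes {1..n}" "n \<le> m"
  shows "last_exceedance a c N m (\<lambda>i. x (\<pi> i)) = last_exceedance a c N m x"
  using assms by (simp add: last_exceedance_def centred_mean_permute)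

lemma centred_mean_measurable [measurable]:
  assumes "m \<le> N"
  shows "centred_mean a m \<in> borel_measurable (\<Pi>\<^sub>M i\<in>{1..N}. borel)"
proof -
  have [measurable]: "(\<lambda>x. x i) \<in> borel_measurable (\<Pi>\<^sub>M i\<in>{1..N}. (borel :: real measure))"
    if "i \<in> {1..m}" for i
    using that assms by (intro measurable_component_singleton) auto
  show ?thesis unfolding centred_mean_def by measurable
qed

lemma last_exceedance_measurable [measurable]:
  assumes "m \<le> N"
  shows "Measurable.pred (\<Pi>\<^sub>M i\<in>{1..N}. borel) (last_exceedance a c N m)"
proof -
  have [measurable]: "centred_mean a j \<in> borel_measurable (\<Pi>\<^sub>M i\<in>{1..N}. borel)"
    if "j \<in> insert m {m<..N}" for j
    using that assms by (intro centred_mean_measurable) auto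
  show ?thesis unfolding last_exceedance_def by measurable
qed

section \<open>Exchangeability and leave-one-out averaging\<close>

lemma exchangeable_measurable:
  "exchangeable M X \<Longrightarrow> i \<ge> 1 \<Longrightarrow> X i \<in> borel_measurable M"
  by (simp add: exchangeable_def)

text \<open>Both sides are integrals of \<open>F\<close> against laws that exchangeability equates.
  Those laws live on functions extensional on \<open>{1..N}\<close>, hence the requirement that
  \<open>F\<close> ignore all other coordinates.\<close>

lemma exchangeable_integral_permute:
  fixes F :: "(nat \<Rightarrow> real) \<Rightarrow> real"
  assumes X: "exchangeable M X" and "N \<ge> 1" and \<pi>: "\<pi> permutes {1..N}"
    and [measurable]: "F \<in> borel_measurable (\<Pi>\<^sub>M i\<in>{1..N}. borel)"
    and F: "\<And>x. F (restrict x {1..N}) = F x"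
  shows "(\<integral>\<omega>. F (\<lambda>i. X (\<pi> i) \<omega>) \<partial>M) = (\<integral>\<omega>. F (\<lambda>i. X i \<omega>) \<partial>M)"
proof -
  have *: "(\<integral>\<omega>. F (\<lambda>i. X (\<rho> i) \<omega>) \<partial>M) =
      integral\<^sup>L (distr M (\<Pi>\<^sub>M i\<in>{1..N}. borel) (\<lambda>\<omega>. \<lambda>i\<in>{1..N}. X (\<rho> i) \<omega>)) F"
    if \<rho>: "\<rho> permutes {1..N}" for \<rho>
  proof -
    have [measurable]: "X (\<rho> i) \<in> borel_measurable M" if "i \<in> {1..N}" for i
      using permutes_in_image[OF \<rho>, of i] that by (intro exchangeable_measurable[OF X]) auto
    have "(\<lambda>\<omega>. \<lambda>i\<in>{1..N}. X (\<rho> i) \<omega>) \<in> measurable M (\<Pi>\<^sub>M i\<in>{1..N}. borel)"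
      by (intro measurable_restrict) auto
    then show ?thesis by (subst integral_distr) (simp_all add: F del: One_nat_def)
  qed
  have "distr M (\<Pi>\<^sub>M i\<in>{1..N}. borel) (\<lambda>\<omega>. \<lambda>i\<in>{1..N}. X i \<omega>) =
      distr M (\<Pi>\<^sub>M i\<in>{1..N}. borel) (\<lambda>\<omega>. \<lambda>i\<in>{1..N}. X (\<pi> i) \<omega>)"
    using X \<open>N \<ge> 1\<close> \<pi> unfolding exchangeable_def by blast
  with *[OF \<pi>] *[OF permutes_id] show ?thesis by simp
qed

text \<open>The mean of the first \<open>n + 1\<close> terms averages the leave-one-out means of \<open>n\<close> of them.\<close>

lemma centred_mean_Suc_power2_le:
  assumes "n \<ge> 1"
  shows "(centred_mean a (Suc n) x)\<^sup>2 \<le>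
    (\<Sum>i=1..Suc n. (centred_mean a n (\<lambda>j. x (Transposition.transpose i (Suc n) j)))\<^sup>2) / real (Suc n)"
proof -
  let ?S = "\<Sum>j=1..Suc n. x j"
  let ?L = "\<lambda>i. centred_mean a n (\<lambda>j. x (Transposition.transpose i (Suc n) j))"
  \<comment> \<open>Swapping \<open>i\<close> with \<open>Suc n\<close> moves \<open>x i\<close> to
    the last position, so the first \<open>n\<close> terms sum to \<open>?S - x i\<close>.\<close>
  have L: "?L i = (?S - x i) / n - a" if i: "i \<in> {1..Suc n}" for i
  proof -
    have "Transposition.transpose i (Suc n) permutes {1..Suc n}"
      using i by (intro permutes_swap_id) auto
    then have "(\<Sum>j=1..Suc n. x (Transposition.transpose i (Suc n) j)) = ?S"
      using sum.permute[of "Transposition.transpose i (Suc n)" "{1..Suc n}" x] by (simp add: o_def)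
    then show ?thesis by (simp add: centred_mean_def algebra_simps)
  qed
  have "(\<Sum>i=1..Suc n. ?L i) = (\<Sum>i=1..Suc n. (?S - x i) / n - a)"
    by (intro sum.cong L refl)
  \<comment> \<open>Each term is left out exactly once, so the omitted terms add up to
    \<open>?S\<close>.\<close>
  also have "\<dots> = (real (Suc n) * ?S - ?S) / n - real (Suc n) * a"
    by (simp only: sum_subtractf sum_divide_distrib[symmetric]) simp
  also have "\<dots> = real (Suc n) * centred_mean a (Suc n) x"
    using assms by (simp add: centred_mean_def field_simps)
  finally have eq: "(\<Sum>i=1..Suc n. ?L i) = real (Suc n) * centred_mean a (Suc n) x" .
  \<comment> \<open>Cauchy-Schwarz, that is, convexity of the square.\<close>
  have "(\<Sum>i=1..Suc n. ?L i)\<^sup>2 \<le> (\<Sum>i=1..Suc n. (?L i)\<^sup>2) * real (Suc n)"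
    using sum_squared_le_sum_of_squares[of ?L "{1..Suc n}"] by simp
  then have "real (Suc n) * (real (Suc n) * (centred_mean a (Suc n) x)\<^sup>2) \<le>
      real (Suc n) * (\<Sum>i=1..Suc n. (?L i)\<^sup>2)"
    unfolding eq by (simp add: power2_eq_square mult_ac del: of_nat_Suc sum.cl_ivl_Suc)
  then have "real (Suc n) * (centred_mean a (Suc n) x)\<^sup>2 \<le> (\<Sum>i=1..Suc n. (?L i)\<^sup>2)"
    by (rule mult_left_le_imp_le) simp
  then show ?thesis by (simp add: field_simps del: of_nat_Suc sum.cl_ivl_Suc)
qed

section \<open>Measurability and second moments of the means\<close>

context prob_space
begin

lemma centred_mean_random_variable:
  assumes "\<And>i. i \<ge> 1 \<Longrightarrow> random_variable borel (X i)" "\<And>i. i \<in> {1..m} \<Longrightarrow> f i \<ge> 1"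
  shows "random_variable borel (\<lambda>\<omega>. centred_mean a m (\<lambda>i. X (f i) \<omega>))"
proof -
  have [measurable]: "random_variable borel (X (f i))" if "i \<in> {1..m}" for i
    using assms that by blast
  show ?thesis unfolding centred_mean_def by measurable
qed

text \<open>By Cauchy-Schwarz the squared sum is dominated by a multiple of the sum of squares. The
  index map \<open>f\<close> serves both the original sequence and its transpositions.\<close>

lemma integrable_centred_mean_power2:
  fixes X :: "nat \<Rightarrow> 'a \<Rightarrow> real"
  assumes X: "\<And>i. i \<ge> 1 \<Longrightarrow> random_variable borel (X i)"
    and X2: "\<And>i. i \<ge> 1 \<Longrightarrow> integrable M (\<lambda>\<omega>. (X i \<omega>)\<^sup>2)"
    and f: "\<And>i. i \<in> {1..m} \<Longrightarrow> f i \<ge> 1"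
  shows "integrable M (\<lambda>\<omega>. (centred_mean a m (\<lambda>i. X (f i) \<omega>))\<^sup>2)"
proof -
  let ?S = "\<lambda>\<omega>. \<Sum>i=1..m. X (f i) \<omega>"
  have [measurable]: "random_variable borel (X (f i))" if "i \<in> {1..m}" for i
    using that f X by blast
  have S2: "integrable M (\<lambda>\<omega>. (?S \<omega>)\<^sup>2)"
  proof (rule Bochner_Integration.integrable_bound)
    show "integrable M (\<lambda>\<omega>. (\<Sum>i=1..m. (X (f i) \<omega>)\<^sup>2) * real m)"
      using f by (intro integrable_mult_left Bochner_Integration.integrable_sum X2)
    show "AE \<omega> in M. norm ((?S \<omega>)\<^sup>2) \<le> norm ((\<Sum>i=1..m. (X (f i) \<omega>)\<^sup>2) * real m)"
    proof (intro AE_I2)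
      fix \<omega>
      show "norm ((?S \<omega>)\<^sup>2) \<le> norm ((\<Sum>i=1..m. (X (f i) \<omega>)\<^sup>2) * real m)"
        using sum_squared_le_sum_of_squares[of "\<lambda>i. X (f i) \<omega>" "{1..m}"]
        by (simp add: abs_mult sum_nonneg)
    qed
  qed simp
  have S: "integrable M ?S"
    by (rule square_integrable_imp_integrable[OF _ S2]) measurable
  have "(centred_mean a m (\<lambda>i. X (f i) \<omega>))\<^sup>2 =
      1 / (real m)\<^sup>2 * (?S \<omega>)\<^sup>2 + a\<^sup>2 - 2 * a / real m * ?S \<omega>" for \<omega>
    by (simp add: centred_mean_def power2_diff power_divide)
  moreover have "integrable M (\<lambda>\<omega>. 1 / (real m)\<^sup>2 * (?S \<omega>)\<^sup>2 + a\<^sup>2 - 2 * a / real m * ?S \<omega>)"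
    by (intro Bochner_Integration.integrable_diff Bochner_Integration.integrable_add
        integrable_mult_right integrable_const S S2)
  ultimately show ?thesis by presburger
qed

lemma last_exceedance_pred:
  assumes X: "\<And>i. i \<ge> 1 \<Longrightarrow> random_variable borel (X i)"
  shows "Measurable.pred M (\<lambda>\<omega>. last_exceedance a c N m (\<lambda>i. X i \<omega>))"
proof -
  have [measurable]: "random_variable borel (\<lambda>\<omega>. centred_mean a j (\<lambda>i. X i \<omega>))" for j
    using X by (intro centred_mean_random_variable[where f = "\<lambda>i. i"]) auto
  show ?thesis unfolding last_exceedance_def by measurable
qed

section \<open>Reverse submartingale inequality\<close>

text \<open>Explicit averages over swaps take the place of conditional expectations: the swaps fix
  the event, and exchangeability gives all leave-one-out terms the same expectation.\<close>

lemma expectation_centred_mean_power2_antimono: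
  fixes X :: "nat \<Rightarrow> 'a \<Rightarrow> real"
  assumes ex: "exchangeable M X"
    and X2: "\<And>i. i \<ge> 1 \<Longrightarrow> integrable M (\<lambda>\<omega>. (X i \<omega>)\<^sup>2)"
    and "1 \<le> n" "n \<le> m" "m \<le> N"
  shows "expectation (\<lambda>\<omega>. (centred_mean a m (\<lambda>i. X i \<omega>))\<^sup>2 *
             of_bool (last_exceedance a c N m (\<lambda>i. X i \<omega>))) \<le>
         expectation (\<lambda>\<omega>. (centred_mean a n (\<lambda>i. X i \<omega>))\<^sup>2 *
             of_bool (last_exceedance a c N m (\<lambda>i. X i \<omega>)))"
  using \<open>n \<le> m\<close> \<open>1 \<le> n\<close>
proof (induction n rule: inc_induct)
  case base
  then show ?case by simp
next
  \<comment> \<open>The induction descends from \<open>m\<close>: the inequality is known for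
    \<open>Suc n\<close>, which is at most \<open>m\<close>, and is wanted for
    \<open>n\<close>.\<close>
  case (step n)
  let ?B = "\<lambda>x. of_bool (last_exceedance a c N m x) :: real"
  let ?F = "\<lambda>x. (centred_mean a n x)\<^sup>2 * ?B x"
  let ?\<tau> = "\<lambda>i. Transposition.transpose i (Suc n)"
  note rv = exchangeable_measurable[OF ex]
  note [measurable] = last_exceedance_pred[OF rv]
  have n: "n \<ge> 1" "n \<le> N" "Suc n \<le> m" using step.hyps step.prems \<open>m \<le> N\<close> by auto
  have \<tau>: "?\<tau> i permutes {1..Suc n}" if "i \<in> {1..Suc n}" for i
    using that by (intro permutes_swap_id) auto
  have int: "integrable M (\<lambda>\<omega>. (centred_mean a l (\<lambda>j. X (f j) \<omega>))\<^sup>2 * ?B (\<lambda>j. X j \<omega>))"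
    if "\<And>j. j \<in> {1..l} \<Longrightarrow> f j \<ge> 1" for f l
  proof (rule Bochner_Integration.integrable_bound)
    show "integrable M (\<lambda>\<omega>. (centred_mean a l (\<lambda>j. X (f j) \<omega>))\<^sup>2)"
      using that by (intro integrable_centred_mean_power2[OF rv X2])
    have [measurable]: "random_variable borel (\<lambda>\<omega>. centred_mean a l (\<lambda>j. X (f j) \<omega>))"
      using that by (intro centred_mean_random_variable[OF rv])
    show "random_variable borel (\<lambda>\<omega>. (centred_mean a l (\<lambda>j. X (f j) \<omega>))\<^sup>2 * ?B (\<lambda>j. X j \<omega>))"
      by measurable
  qed simp
  have int\<tau>: "integrable M (\<lambda>\<omega>. (centred_mean a n (\<lambda>j. X (?\<tau> i j) \<omega>))\<^sup>2 * ?B (\<lambda>j. X j \<omega>))"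
    if "i \<in> {1..Suc n}" for i
    using that by (intro int) (auto simp: Transposition.transpose_def)
  have perm: "expectation (\<lambda>\<omega>. (centred_mean a n (\<lambda>j. X (?\<tau> i j) \<omega>))\<^sup>2 * ?B (\<lambda>j. X j \<omega>)) =
      expectation (\<lambda>\<omega>. ?F (\<lambda>j. X j \<omega>))" if i: "i \<in> {1..Suc n}" for i
  proof -
    \<comment> \<open>As \<open>Suc n \<le> m\<close>, the swap may be inserted into the event as
      well, which turns the integrand into \<open>?F\<close> of the swapped sequence.\<close>
    have "expectation (\<lambda>\<omega>. (centred_mean a n (\<lambda>j. X (?\<tau> i j) \<omega>))\<^sup>2 * ?B (\<lambda>j. X j \<omega>)) =
        expectation (\<lambda>\<omega>. ?F (\<lambda>j. X (?\<tau> i j) \<omega>))"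
      using n by (intro Bochner_Integration.integral_cong refl)
        (simp add: last_exceedance_permute[OF \<tau>[OF i], where x = "\<lambda>j. X j _"])
    also have "\<dots> = expectation (\<lambda>\<omega>. ?F (\<lambda>j. X j \<omega>))"
    proof (rule exchangeable_integral_permute[OF ex, where N = N])
      show "?\<tau> i permutes {1..N}" using \<tau>[OF i] n \<open>m \<le> N\<close> by (auto intro: permutes_subset)
      have [measurable]: "centred_mean a n \<in> borel_measurable (\<Pi>\<^sub>M i\<in>{1..N}. borel)"
        "Measurable.pred (\<Pi>\<^sub>M i\<in>{1..N}. borel) (last_exceedance a c N m)"
        using n \<open>m \<le> N\<close> by (auto intro!: centred_mean_measurable last_exceedance_measurable simp del: One_nat_def)
      show "?F \<in> borel_measurable (\<Pi>\<^sub>M i\<in>{1..N}. borel)" by measurable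
      show "?F (restrict x {1..N}) = ?F x" for x
        using n \<open>m \<le> N\<close> centred_mean_cong[of n "restrict x {1..N}" x a]
          last_exceedance_cong[of N "restrict x {1..N}" x m a c] by simp
    qed (use n in simp)
    finally show ?thesis .
  qed
  have "expectation (\<lambda>\<omega>. (centred_mean a m (\<lambda>i. X i \<omega>))\<^sup>2 * ?B (\<lambda>i. X i \<omega>)) \<le>
      expectation (\<lambda>\<omega>. (centred_mean a (Suc n) (\<lambda>i. X i \<omega>))\<^sup>2 * ?B (\<lambda>i. X i \<omega>))"
    using step.IH by simp
  \<comment> \<open>The leave-one-out bound holds pointwise and survives multiplication by the
    nonnegative indicator.\<close>
  also have "\<dots> \<le> expectation (\<lambda>\<omega>.
      (\<Sum>i=1..Suc n. (centred_mean a n (\<lambda>j. X (?\<tau> i j) \<omega>))\<^sup>2 * ?B (\<lambda>j. X j \<omega>)) / real (Suc n))"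
  proof (rule integral_mono)
    show "integrable M (\<lambda>\<omega>. (centred_mean a (Suc n) (\<lambda>i. X i \<omega>))\<^sup>2 * ?B (\<lambda>i. X i \<omega>))"
      using int[of "Suc n" "\<lambda>i. i"] by simp
    show "integrable M (\<lambda>\<omega>. (\<Sum>i=1..Suc n.
        (centred_mean a n (\<lambda>j. X (?\<tau> i j) \<omega>))\<^sup>2 * ?B (\<lambda>j. X j \<omega>)) / real (Suc n))"
      by (intro Bochner_Integration.integrable_divide Bochner_Integration.integrable_sum int\<tau>)
    show "(centred_mean a (Suc n) (\<lambda>i. X i \<omega>))\<^sup>2 * ?B (\<lambda>i. X i \<omega>) \<le>
        (\<Sum>i=1..Suc n. (centred_mean a n (\<lambda>j. X (?\<tau> i j) \<omega>))\<^sup>2 * ?B (\<lambda>j. X j \<omega>)) / real (Suc n)" for \<omega>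
      using centred_mean_Suc_power2_le[OF n(1), of a "\<lambda>i. X i \<omega>"] by auto
  qed
  also have "\<dots> = (\<Sum>i=1..Suc n. expectation (\<lambda>\<omega>.
      (centred_mean a n (\<lambda>j. X (?\<tau> i j) \<omega>))\<^sup>2 * ?B (\<lambda>j. X j \<omega>))) / real (Suc n)"
    by (simp only: integral_divide_zero Bochner_Integration.integral_sum[OF int\<tau>])
  also have "\<dots> = (\<Sum>i=1..Suc n. expectation (\<lambda>\<omega>. ?F (\<lambda>j. X j \<omega>))) / real (Suc n)"
    by (simp only: perm cong: sum.cong)
  also have "\<dots> = expectation (\<lambda>\<omega>. ?F (\<lambda>j. X j \<omega>))" by simp
  finally show ?case .
qed

section \<open>Maximal inequality\<close>

text \<open>Doob's maximal argument with time reversed: reading the indices from \<open>N\<close>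
  down to \<open>n\<close>, the last exceedance is the first time the level \<open>c\<close> is
  reached.\<close>

lemma exchangeable_maximal_inequality_finite:
  fixes X :: "nat \<Rightarrow> 'a \<Rightarrow> real"
  assumes ex: "exchangeable M X"
    and X2: "\<And>i. i \<ge> 1 \<Longrightarrow> integrable M (\<lambda>\<omega>. (X i \<omega>)\<^sup>2)"
    and "1 \<le> n" "0 < c"
  shows "prob {\<omega> \<in> space M. \<exists>m\<in>{n..N}. c \<le> \<bar>centred_mean a m (\<lambda>i. X i \<omega>)\<bar>}
    \<le> expectation (\<lambda>\<omega>. (centred_mean a n (\<lambda>i. X i \<omega>))\<^sup>2) / c\<^sup>2"
proof -
  let ?A = "\<lambda>m \<omega>. centred_mean a m (\<lambda>i. X i \<omega>)"
  let ?L = "\<lambda>m \<omega>. last_exceedance a c N m (\<lambda>i. X i \<omega>)"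
  let ?E = "\<lambda>m. {\<omega> \<in> space M. ?L m \<omega>}"
  note rv = exchangeable_measurable[OF ex]
  note [measurable] = last_exceedance_pred[OF rv]
  have intA: "integrable M (\<lambda>\<omega>. (?A m \<omega>)\<^sup>2)" for m
    using integrable_centred_mean_power2[OF rv X2, where f = "\<lambda>i. i"] by simp
  have int: "integrable M (\<lambda>\<omega>. (?A l \<omega>)\<^sup>2 * of_bool (?L m \<omega>))" for l m
  proof (rule Bochner_Integration.integrable_bound[OF intA[of l]])
    have [measurable]: "random_variable borel (?A l)"
      using centred_mean_random_variable[OF rv, where f = "\<lambda>i. i"] by simp
    show "random_variable borel (\<lambda>\<omega>. (?A l \<omega>)\<^sup>2 * of_bool (?L m \<omega>))"
      by measurable
  qed simp
  \<comment> \<open>The smaller of two distinct such indices would force the deviation at the larger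
    one below \<open>c\<close>.\<close>
  have disj: "m = m'" if "?L m \<omega>" "?L m' \<omega>" "m \<in> {n..N}" "m' \<in> {n..N}" for m m' \<omega>
    using that by (cases m m' rule: linorder_cases) (force simp: last_exceedance_def)+
  have E: "{\<omega> \<in> space M. \<exists>m\<in>{n..N}. c \<le> \<bar>?A m \<omega>\<bar>} = (\<Union>m\<in>{n..N}. ?E m)"
  proof -
    have "\<exists>m\<in>{n..N}. ?L m \<omega>" if m: "m \<in> {n..N}" "c \<le> \<bar>?A m \<omega>\<bar>" for m \<omega>
    proof -
      \<comment> \<open>The witness is the largest exceedance index in the finite window.\<close>
      let ?J = "{j \<in> {n..N}. c \<le> \<bar>?A j \<omega>\<bar>}"
      have J: "finite ?J" "?J \<noteq> {}" using m by auto
      have "?L (Max ?J) \<omega>"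
        unfolding last_exceedance_def
      proof (intro conjI ballI)
        show "c \<le> \<bar>?A (Max ?J) \<omega>\<bar>" using Max_in[OF J] by blast
        show "\<bar>?A j \<omega>\<bar> < c" if "j \<in> {Max ?J<..N}" for j
        proof (rule ccontr)
          assume "\<not> \<bar>?A j \<omega>\<bar> < c"
          moreover have "n \<le> j" using that Max_in[OF J] by auto
          ultimately have "j \<in> ?J" using that by auto
          then have "j \<le> Max ?J" by (rule Max_ge[OF J(1)])
          then show False using that by simp
        qed
      qed
      then show ?thesis using Max_in[OF J] by blast
    qed
    then show ?thesis by (auto simp: last_exceedance_def)
  qed
  have step: "c\<^sup>2 * prob (?E m) \<le> expectation (\<lambda>\<omega>. (?A n \<omega>)\<^sup>2 * of_bool (?L m \<omega>))"
    if m: "m \<in> {n..N}" for m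
  proof -
    have "c\<^sup>2 * prob (?E m) = expectation (\<lambda>\<omega>. c\<^sup>2 * indicator (?E m) \<omega>)"
      by simp
    \<comment> \<open>Chebyshev at the index \<open>m\<close> itself, where membership in
      \<open>?E m\<close> guarantees a deviation of at least \<open>c\<close>.\<close>
    also have "\<dots> \<le> expectation (\<lambda>\<omega>. (?A m \<omega>)\<^sup>2 * of_bool (?L m \<omega>))"
    proof (rule integral_mono[OF _ int])
      show "integrable M (\<lambda>\<omega>. c\<^sup>2 * indicator (?E m) \<omega> :: real)"
        by (intro integrable_mult_right integrable_real_indicator) (auto simp: emeasure_eq_measure)
      fix \<omega>
      show "c\<^sup>2 * indicator (?E m) \<omega> \<le> (?A m \<omega>)\<^sup>2 * of_bool (?L m \<omega>)"
        using \<open>0 < c\<close> abs_le_square_iff[of c "?A m \<omega>"]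
        by (auto simp: indicator_def last_exceedance_def)
    qed
    also have "\<dots> \<le> expectation (\<lambda>\<omega>. (?A n \<omega>)\<^sup>2 * of_bool (?L m \<omega>))"
      using m by (intro expectation_centred_mean_power2_antimono[OF ex X2 \<open>1 \<le> n\<close>]) auto
    finally show ?thesis .
  qed
  have "c\<^sup>2 * prob (\<Union>m\<in>{n..N}. ?E m) = (\<Sum>m\<in>{n..N}. c\<^sup>2 * prob (?E m))"
    using disj by (subst finite_measure_finite_Union)
      (auto simp: disjoint_family_on_def sum_distrib_left)
  also have "\<dots> \<le> (\<Sum>m\<in>{n..N}. expectation (\<lambda>\<omega>. (?A n \<omega>)\<^sup>2 * of_bool (?L m \<omega>)))"
    by (intro sum_mono step)
  also have "\<dots> = expectation (\<lambda>\<omega>. \<Sum>m\<in>{n..N}. (?A n \<omega>)\<^sup>2 * of_bool (?L m \<omega>))"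
    by (intro Bochner_Integration.integral_sum[symmetric] int)
  also have "\<dots> \<le> expectation (\<lambda>\<omega>. (?A n \<omega>)\<^sup>2)"
  proof (rule integral_mono)
    fix \<omega>
    \<comment> \<open>The pieces are disjoint, so at most one summand is nonzero.\<close>
    show "(\<Sum>m\<in>{n..N}. (?A n \<omega>)\<^sup>2 * of_bool (?L m \<omega>)) \<le> (?A n \<omega>)\<^sup>2"
    proof (cases "\<exists>m\<in>{n..N}. ?L m \<omega>")
      case True
      then obtain m where m: "m \<in> {n..N}" "?L m \<omega>" by blast
      have "(\<Sum>m'\<in>{n..N}. (?A n \<omega>)\<^sup>2 * of_bool (?L m' \<omega>)) =
          (\<Sum>m'\<in>{n..N}. if m' = m then (?A n \<omega>)\<^sup>2 else 0)"
        using m disj by (intro sum.cong) auto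
      then show ?thesis by simp
    qed simp
  next
    show "integrable M (\<lambda>\<omega>. \<Sum>m\<in>{n..N}. (?A n \<omega>)\<^sup>2 * of_bool (?L m \<omega>))"
      by (intro Bochner_Integration.integrable_sum int)
  qed (rule intA)
  finally show ?thesis
    using \<open>0 < c\<close> by (simp add: E field_simps)
qed

text \<open>The finite bound does not depend on \<open>N\<close>, so continuity of the measure along
  increasing events extends it to all \<open>m \<ge> n\<close>.\<close>

theorem exchangeable_maximal_inequality:
  fixes X :: "nat \<Rightarrow> 'a \<Rightarrow> real"
  assumes ex: "exchangeable M X"
    and X2: "\<And>i. i \<ge> 1 \<Longrightarrow> integrable M (\<lambda>\<omega>. (X i \<omega>)\<^sup>2)"
    and "1 \<le> n" "0 < c"
  shows "prob {\<omega> \<in> space M. ereal c \<le> (SUP m\<in>{n..}. ereal \<bar>centred_mean a m (\<lambda>i. X i \<omega>)\<bar>)}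
    \<le> expectation (\<lambda>\<omega>. (centred_mean a n (\<lambda>i. X i \<omega>))\<^sup>2) / c\<^sup>2"
proof -
  let ?A = "\<lambda>m \<omega>. centred_mean a m (\<lambda>i. X i \<omega>)"
  let ?V = "expectation (\<lambda>\<omega>. (?A n \<omega>)\<^sup>2)"
  let ?S = "{\<omega> \<in> space M. ereal c \<le> (SUP m\<in>{n..}. ereal \<bar>?A m \<omega>\<bar>)}"
  have [measurable]: "random_variable borel (?A m)" for m
    using exchangeable_measurable[OF ex]
    by (intro centred_mean_random_variable[where f = "\<lambda>i. i"]) auto
  \<comment> \<open>The supremum need not be attained, so the level is first lowered to \<open>d < c\<close>.\<close>
  have bound: "prob ?S \<le> ?V / d\<^sup>2" if d: "0 < d" "d < c" for d
  proof -
    let ?E = "\<lambda>N. {\<omega> \<in> space M. \<exists>m\<in>{n..N}. d \<le> \<bar>?A m \<omega>\<bar>}"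
    have "?S \<subseteq> (\<Union>N. ?E N)"
    proof
      fix \<omega> assume \<omega>: "\<omega> \<in> ?S"
      then have "ereal d < (SUP m\<in>{n..}. ereal \<bar>?A m \<omega>\<bar>)"
        using d by (auto intro: less_le_trans[of _ "ereal c"])
      \<comment> \<open>Strictness yields a single mean deviating by more than \<open>d\<close>; its
        index also serves as the horizon \<open>N\<close>.\<close>
      then obtain m where "m \<ge> n" "d < \<bar>?A m \<omega>\<bar>" by (auto simp: less_SUP_iff)
      then show "\<omega> \<in> (\<Union>N. ?E N)" using \<omega> by (auto intro!: exI[of _ m] bexI[of _ m])
    qed
    then have "prob ?S \<le> prob (\<Union>N. ?E N)"
      by (intro finite_measure_mono) measurable
    also have "\<dots> \<le> ?V / d\<^sup>2"
    proof (rule LIMSEQ_le_const2)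
      show "(\<lambda>N. prob (?E N)) \<longlonglongrightarrow> prob (\<Union>N. ?E N)"
      proof (rule finite_Lim_measure_incseq)
        show "range ?E \<subseteq> events" by (intro image_subsetI) measurable
        show "incseq ?E" unfolding incseq_def by fastforce
      qed
      show "\<exists>N0. \<forall>N\<ge>N0. prob (?E N) \<le> ?V / d\<^sup>2"
        using exchangeable_maximal_inequality_finite[OF ex X2 \<open>1 \<le> n\<close> d(1)] by blast
    qed
    finally show ?thesis .
  qed
  \<comment> \<open>The bound is continuous in \<open>d\<close> at \<open>c > 0\<close>, so letting
    \<open>d\<close> increase to \<open>c\<close> restores the original level.\<close>
  have "((\<lambda>d. ?V / d\<^sup>2) \<longlongrightarrow> ?V / c\<^sup>2) (at_left c)"
    using \<open>0 < c\<close> by (intro tendsto_intros) auto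
  moreover have "\<forall>\<^sub>F d in at_left c. prob ?S \<le> ?V / d\<^sup>2"
    using eventually_at_left_real[OF \<open>0 < c\<close>] by eventually_elim (use bound in auto)
  ultimately show ?thesis
    by (rule tendsto_lowerbound) simp
qed

section \<open>Variance of the mean of i.i.d. variables\<close>

lemma iid_expectation_eq:
  assumes "iid M X" "i \<ge> 1"
  shows "expectation (X i) = expectation (X 1)"
proof -
  have [measurable]: "random_variable borel (X j)" if "j \<ge> 1" for j
    using assms(1) that unfolding iid_def indep_vars_def by auto
  have "expectation (X j) = integral\<^sup>L (distr M borel (X j)) (\<lambda>x. x)" if "j \<ge> 1" for j
    using that by (simp add: integral_distr)
  moreover have "distr M borel (X i) = distr M borel (X 1)"
    using assms unfolding iid_def by blast
  ultimately show ?thesis using \<open>i \<ge> 1\<close> by simp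
qed

text \<open>When the square is expanded, independence kills the off-diagonal covariances. What
  remains is \<open>n\<close> variances, each at most \<open>v\<close>, divided by the square of
  \<open>n\<close>.\<close>

lemma iid_expectation_centred_mean_power2_le:
  fixes X :: "nat \<Rightarrow> 'a \<Rightarrow> real"
  assumes iid: "iid M X"
    and X2: "\<And>i. i \<ge> 1 \<Longrightarrow> integrable M (\<lambda>\<omega>. (X i \<omega>)\<^sup>2)"
    and var: "\<And>i. i \<ge> 1 \<Longrightarrow> variance (X i) \<le> v"
    and "n \<ge> 1"
  shows "expectation (\<lambda>\<omega>. (centred_mean (expectation (X 1)) n (\<lambda>i. X i \<omega>))\<^sup>2) \<le> v / n"
proof -
  let ?\<mu> = "expectation (X 1)"
  let ?Y = "\<lambda>i \<omega>. X i \<omega> - ?\<mu>"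
  have rv [measurable]: "random_variable borel (X i)" if "i \<ge> 1" for i
    using iid that unfolding iid_def indep_vars_def by blast
  have X1: "integrable M (X i)" if "i \<ge> 1" for i
    using that by (intro square_integrable_imp_integrable[OF rv X2])
  have Y1: "integrable M (?Y i)" "expectation (?Y i) = 0" if "i \<ge> 1" for i
    using that X1 iid_expectation_eq[OF iid, of i] by (auto simp: prob_space)
  have indep: "indep_vars (\<lambda>_. borel) ?Y {1..}"
  proof (rule indep_vars_compose2[where M' = "\<lambda>_. borel" and X = X])
    show "indep_vars (\<lambda>_. borel) X {1..}" using iid by (simp add: iid_def)
  qed simp
  have cov: "integrable M (\<lambda>\<omega>. ?Y i \<omega> * ?Y j \<omega>)"
      "expectation (\<lambda>\<omega>. ?Y i \<omega> * ?Y j \<omega>) \<le> (if i = j then v else 0)"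
    if ij: "i \<in> {1..n}" "j \<in> {1..n}" for i j
  proof -
    have "integrable M (\<lambda>\<omega>. ?Y i \<omega> * ?Y j \<omega>) \<and>
      expectation (\<lambda>\<omega>. ?Y i \<omega> * ?Y j \<omega>) \<le> (if i = j then v else 0)"
    proof (cases "i = j")
      case True
      have "integrable M (\<lambda>\<omega>. (?Y i \<omega>)\<^sup>2)"
        using ij X1 X2 by (auto simp: power2_diff)
      then show ?thesis
        using True var[of i] iid_expectation_eq[OF iid, of i] ij by (auto simp: power2_eq_square)
    next
      case False
      have I: "indep_vars (\<lambda>_. borel) ?Y {i, j}"
        by (rule indep_vars_subset[OF indep]) (use ij in auto)
      have Y: "integrable M (?Y l)" if "l \<in> {i, j}" for l
        using that ij by (intro Y1) auto
      \<comment> \<open>The expectation of the product factors, and the factor at \<open>i\<close>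
        is zero.\<close>
      show ?thesis
        using indep_vars_lebesgue_integral[OF _ I Y] indep_vars_integrable[OF _ I Y]
          False ij Y1(2)[of i]
        by simp
    qed
    then show "integrable M (\<lambda>\<omega>. ?Y i \<omega> * ?Y j \<omega>)"
      "expectation (\<lambda>\<omega>. ?Y i \<omega> * ?Y j \<omega>) \<le> (if i = j then v else 0)" by auto
  qed
  have "centred_mean ?\<mu> n (\<lambda>i. X i \<omega>) = (\<Sum>i=1..n. ?Y i \<omega>) / n" for \<omega>
    using \<open>n \<ge> 1\<close> by (simp add: centred_mean_def sum_subtractf field_simps)
  then have "expectation (\<lambda>\<omega>. (centred_mean ?\<mu> n (\<lambda>i. X i \<omega>))\<^sup>2) =
      expectation (\<lambda>\<omega>. (\<Sum>i=1..n. \<Sum>j=1..n. ?Y i \<omega> * ?Y j \<omega>) / (real n)\<^sup>2)"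
    by (simp add: power_divide power2_eq_square[of "sum _ _"] sum_product)
  also have "\<dots> = (\<Sum>i=1..n. \<Sum>j=1..n. expectation (\<lambda>\<omega>. ?Y i \<omega> * ?Y j \<omega>)) / (real n)\<^sup>2"
  proof -
    have "expectation (\<lambda>\<omega>. \<Sum>i=1..n. \<Sum>j=1..n. ?Y i \<omega> * ?Y j \<omega>) =
        (\<Sum>i=1..n. expectation (\<lambda>\<omega>. \<Sum>j=1..n. ?Y i \<omega> * ?Y j \<omega>))"
      by (intro Bochner_Integration.integral_sum Bochner_Integration.integrable_sum cov)
    also have "\<dots> = (\<Sum>i=1..n. \<Sum>j=1..n. expectation (\<lambda>\<omega>. ?Y i \<omega> * ?Y j \<omega>))"
      by (intro sum.cong refl Bochner_Integration.integral_sum cov)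
    finally show ?thesis by (simp only: integral_divide_zero)
  qed
  also have "\<dots> \<le> (\<Sum>i=1..n. \<Sum>j=1..n. if i = j then v else 0) / (real n)\<^sup>2"
    by (intro divide_right_mono sum_mono cov) auto
  also have "\<dots> = v / n"
    by (simp add: power2_eq_square)
  finally show ?thesis .
qed

end

section \<open>Bounds for exchangeable and for i.i.d. sequences\<close>

text \<open>Square integrability is stated explicitly because the Bochner integral of a
  non-integrable function is 0, which would make the variance bound hold vacuously for infinite
  variance.\<close>

theorem theorem2p2:
  fixes M :: "'a measure" and X :: "nat \<Rightarrow> 'a \<Rightarrow> real" and \<sigma> k :: real
  assumes "prob_space M"
    and "exchangeable M X"
    and "\<And>i. i \<ge> 1 \<Longrightarrow> integrable M (\<lambda>\<omega>. (X i \<omega>)\<^sup>2)"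
    and "\<And>i. i \<ge> 1 \<Longrightarrow> prob_space.variance M (X i) \<le> \<sigma>\<^sup>2"
    and "\<sigma> > 0"
    and "k > 1"
  shows "measure M {\<omega> \<in> space M. sup_deviation M X 1 \<omega> \<ge> ereal (k * \<sigma>)} \<le> 1 / k\<^sup>2 \<and>
    (iid M X \<longrightarrow>
      (\<forall>n\<ge>1. measure M {\<omega> \<in> space M. sup_deviation M X n \<omega> \<ge> ereal (k * \<sigma> / sqrt (real n))}
         \<le> 1 / k\<^sup>2))"
proof -
  interpret prob_space M by fact
  let ?V = "\<lambda>n. expectation (\<lambda>\<omega>. (centred_mean (expectation (X 1)) n (\<lambda>i. X i \<omega>))\<^sup>2)"
  \<comment> \<open>One argument covers both claims: at the level
    \<open>k * \<sigma> / sqrt (real n)\<close> a second moment of at most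
    \<open>\<sigma>\<^sup>2 / n\<close> cancels both \<open>\<sigma>\<close> and
    \<open>n\<close>.\<close>
  have main: "prob {\<omega> \<in> space M. sup_deviation M X n \<omega> \<ge> ereal (k * \<sigma> / sqrt (real n))} \<le> 1 / k\<^sup>2"
    if n: "n \<ge> 1" and V: "?V n \<le> \<sigma>\<^sup>2 / n" for n
  proof -
    let ?c = "k * \<sigma> / sqrt (real n)"
    have "0 < ?c" using \<open>\<sigma> > 0\<close> \<open>k > 1\<close> n by simp
    from exchangeable_maximal_inequality[OF assms(2,3) n this, of "expectation (X 1)"]
    have "prob {\<omega> \<in> space M. sup_deviation M X n \<omega> \<ge> ereal ?c} \<le> ?V n / ?c\<^sup>2"
      by (simp add: sup_deviation_def sample_mean_eq_centred_mean)
    also have "\<dots> \<le> (\<sigma>\<^sup>2 / n) / ?c\<^sup>2"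
      by (intro divide_right_mono V) simp
    also have "\<dots> = 1 / k\<^sup>2"
      using \<open>\<sigma> > 0\<close> \<open>k > 1\<close> n by (simp add: power_divide power_mult_distrib)
    finally show ?thesis .
  qed
  \<comment> \<open>For \<open>n = 1\<close> the second moment is just the variance of
    \<open>X 1\<close>, so no independence enters.\<close>
  have "?V 1 \<le> \<sigma>\<^sup>2 / real 1"
    using assms(4)[of 1] by (simp add: centred_mean_def)
  then have "prob {\<omega> \<in> space M. sup_deviation M X 1 \<omega> \<ge> ereal (k * \<sigma>)} \<le> 1 / k\<^sup>2"
    using main[of 1] by simp
  moreover have "?V n \<le> \<sigma>\<^sup>2 / n" if "iid M X" "n \<ge> 1" for n
    using that assms(3,4) by (intro iid_expectation_centred_mean_power2_le) auto
  ultimately show ?thesis using main by blast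
qed

end
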